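(* Suppose the matrix $\mathbb{L}$ with entries $L(i,j)=\langle\tilde\phi_i,\phi_j\rangle$, $1\le i,j\le N$, is nonsingular, and let $\mathbf{\Theta}=\mathbb{L}^{-1}\tilde{\mathbf{\Phi}}$. Then $$ \left\langle \mathcal{A}\prod_{j=1}^N \tilde{\phi}_j(\gamma_j), \left( \frac{1}{2}\sum_{i\not=j} \frac{1}{\|\mathbf{r}_i-\mathbf{r}_j\|} \right)\prod_{j=1}^N \phi_j(\gamma_j) \right\rangle $$ is equal to $$ \frac{1}{2}\frac{|\mathbb{L}|}{N!} \int \mathbf{\Phi}^*\mathbf{\Theta}\; \mathcal{W}_{\mathcal{P}}\!\left[\mathbf{\Phi}^*\mathbf{\Theta}\right] - \mathbf{\Phi}^*\,\mathcal{W}_{\mathcal{P}}\!\left[\mathbf{\Theta}\mathbf{\Phi}^*\right]\mathbf{\Theta}\; d\gamma . $$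
   Context: $N\ge1$ is an integer. A particle variable is $\gamma=(\mathbf{r},\sigma)$ with $\mathbf{r}\in\mathbb{R}^3$ and $\sigma\in\{-\frac12,\frac12\}$, and $\int f(\gamma)\,d\gamma=\sum_{\sigma}\int_{\mathbb{R}^3}f(\mathbf{r},\sigma)\,d\mathbf{r}$. The inner product is $\langle f,g\rangle=\int f\,\overline{g}$ (over $\gamma$, or over $\gamma_1,\dots,\gamma_N$ for $N$-particle functions). $\phi_1,\dots,\phi_N$ and $\tilde\phi_1,\dots,\tilde\phi_N$ are complex-valued square-integrable functions of $\gamma$ such that all integrals written converge absolutely. $\mathbf{\Phi}=[\phi_1,\dots,\phi_N]^T$ and $\tilde{\mathbf{\Phi}}=[\tilde\phi_1,\dots,\tilde\phi_N]^T$ are column vectors of functions of one variable, $^*$ is conjugate transpose, and matrices of numbers act on such vectors in the usual way. $|\cdot|$ is the determinant. $\mathcal{A}$ is the antisymmetrizer, $(\mathcal{A}F)(\gamma_1,\dots,\gamma_N)=\frac1{N!}\sum_{\pi\in S_N}\mathrm{sgn}(\pi)F(\gamma_{\pi(1)},\dots,\gamma_{\pi(N)})$, so $\mathcal{A}\prod_i\phi_i(\gamma_i)=\frac1{N!}\det[\phi_i(\gamma_j)]$. The Poisson convolution is $\mathcal{W}_{\mathcal{P}}[f](\mathbf{r})=\int\frac{1}{\|\mathbf{r}-\mathbf{r}'\|}f(\gamma')\,d\gamma'$ (including the sum over the spin $\sigma'$), applied entrywise to vectors and matrices of functions. In an expression such as $\mathbf{\Phi}^*\mathcal{W}_{\mathcal{P}}[\mathbf{\Theta}\mathbf{\Phi}^*]\mathbf{\Theta}$,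 all products are matrix products with pointwise multiplication of functions of the same variable, which is then integrated. *)

theory Defs
  imports "HOL-Analysis.Analysis"
begin

type_synonym particle = "(real^3) \<times> real"

text \<open>The spin coordinate has type \<^typ>\<open>real\<close>; the space of the measure below restricts it to the
  two values \<open>1/2\<close> and \<open>-1/2\<close>.\<close>

definition spins :: "real set" where
  "spins = {- (1/2), 1/2}"

definition particle_measure :: "particle measure" where
  "particle_measure = lborel \<Otimes>\<^sub>M count_space spins"

lemma integral_particle_measure:
  fixes f :: "particle \<Rightarrow> complex"
  assumes "integrable particle_measure f"
  shows "(\<integral>\<gamma>. f \<gamma> \<partial>particle_measure) = (\<Sum>\<sigma>\<in>spins. \<integral>r. f (r, \<sigma>) \<partial>lborel)"
proof -
  have fin: "finite spins" by (simp add: spins_def)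
  interpret S: sigma_finite_measure "count_space spins"
    using fin by (rule sigma_finite_measure_count_space_finite)
  interpret P: pair_sigma_finite "lborel :: (real^3) measure" "count_space spins" ..
  have "(\<integral>\<gamma>. f \<gamma> \<partial>particle_measure) = (\<integral>\<sigma>. (\<integral>r. f (r, \<sigma>) \<partial>lborel) \<partial>count_space spins)"
    using P.integral_snd[of "\<lambda>r \<sigma>. f (r, \<sigma>)"] assms by (simp add: particle_measure_def)
  also have "\<dots> = (\<Sum>\<sigma>\<in>spins. \<integral>r. f (r, \<sigma>) \<partial>lborel)"
    by (rule lebesgue_integral_count_space_finite[OF fin])
  finally show ?thesis .
qed

text \<open>The particle labels are the elements of a finite index type \<open>'n\<close>, so that
  \<open>N = CARD('n) \<ge> 1\<close> and a configuration \<open>(\<gamma>\<^sub>1, \<dots>, \<gamma>\<^sub>N)\<close> is a function on \<open>'n\<close>.\<close>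

definition configuration_measure :: "('n::finite \<Rightarrow> particle) measure" where
  "configuration_measure = PiM UNIV (\<lambda>_. particle_measure)"

definition square_integrable :: "'a measure \<Rightarrow> ('a \<Rightarrow> complex) \<Rightarrow> bool" where
  "square_integrable M f \<longleftrightarrow> f \<in> borel_measurable M \<and> integrable M (\<lambda>x. (cmod (f x))\<^sup>2)"

definition inner_integrand :: "('a \<Rightarrow> complex) \<Rightarrow> ('a \<Rightarrow> complex) \<Rightarrow> 'a \<Rightarrow> complex" where
  "inner_integrand f g = (\<lambda>x. f x * cnj (g x))"

definition inner_L2 :: "'a measure \<Rightarrow> ('a \<Rightarrow> complex) \<Rightarrow> ('a \<Rightarrow> complex) \<Rightarrow> complex" where
  "inner_L2 M f g = (\<integral>x. inner_integrand f g x \<partial>M)"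

definition orbital_product :: "('n::finite \<Rightarrow> particle \<Rightarrow> complex) \<Rightarrow> ('n \<Rightarrow> particle) \<Rightarrow> complex" where
  "orbital_product \<phi> = (\<lambda>\<gamma>. \<Prod>j\<in>UNIV. \<phi> j (\<gamma> j))"

definition antisymmetrizer ::
  "(('n::finite \<Rightarrow> particle) \<Rightarrow> complex) \<Rightarrow> ('n \<Rightarrow> particle) \<Rightarrow> complex" where
  "antisymmetrizer F = (\<lambda>\<gamma>. 1 / fact CARD('n) *
     (\<Sum>\<pi> | \<pi> permutes (UNIV :: 'n set). of_int (sign \<pi>) * F (\<lambda>k. \<gamma> (\<pi> k))))"

definition interaction_potential :: "('n::finite \<Rightarrow> particle) \<Rightarrow> real" where
  "interaction_potential \<gamma> =
     1/2 * (\<Sum>(i, j) | i \<noteq> j. 1 / norm (fst (\<gamma> i) - fst (\<gamma> j)))"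

definition overlap_matrix ::
  "('n::finite \<Rightarrow> particle \<Rightarrow> complex) \<Rightarrow> ('n \<Rightarrow> particle \<Rightarrow> complex) \<Rightarrow> complex^'n^'n" where
  "overlap_matrix \<psi> \<phi> = (\<chi> i j. inner_L2 particle_measure (\<psi> i) (\<phi> j))"

definition orbital_column :: "('n::finite \<Rightarrow> particle \<Rightarrow> complex) \<Rightarrow> particle \<Rightarrow> complex^1^'n" where
  "orbital_column \<phi> \<gamma> = columnvector (\<chi> i. \<phi> i \<gamma>)"

definition conj_transpose :: "complex^'n^'m \<Rightarrow> complex^'m^'n" where
  "conj_transpose A = (\<chi> i j. cnj (A $ j $ i))"

definition poisson_integrand :: "(particle \<Rightarrow> complex) \<Rightarrow> real^3 \<Rightarrow> particle \<Rightarrow> complex" where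
  "poisson_integrand f r = (\<lambda>\<gamma>'. of_real (1 / norm (r - fst \<gamma>')) * f \<gamma>')"

definition poisson_conv :: "(particle \<Rightarrow> complex^'n^'m) \<Rightarrow> real^3 \<Rightarrow> complex^'n^'m" where
  "poisson_conv F r =
     (\<chi> i j. \<integral>\<gamma>'. poisson_integrand (\<lambda>\<gamma>. F \<gamma> $ i $ j) r \<gamma>' \<partial>particle_measure)"

definition poisson_converges :: "(particle \<Rightarrow> complex^'n^'m) \<Rightarrow> bool" where
  "poisson_converges F \<longleftrightarrow>
     (AE r in lborel. \<forall>i j. integrable particle_measure (poisson_integrand (\<lambda>\<gamma>. F \<gamma> $ i $ j) r))"

text \<open>For the columns \<open>P\<close> and \<open>T\<close> this is the \<open>1 \<times> 1\<close> matrix function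
  \<open>P\<^sup>* T W[P\<^sup>* T] - P\<^sup>* W[T P\<^sup>*] T\<close>, where \<open>W\<close> is the Poisson convolution.\<close>

definition direct_minus_exchange ::
  "(particle \<Rightarrow> complex^1^'n::finite) \<Rightarrow> (particle \<Rightarrow> complex^1^'n) \<Rightarrow> particle \<Rightarrow> complex^1^1" where
  "direct_minus_exchange P T \<gamma> =
     (conj_transpose (P \<gamma>) ** T \<gamma>) **
       poisson_conv (\<lambda>\<gamma>'. conj_transpose (P \<gamma>') ** T \<gamma>') (fst \<gamma>)
     - conj_transpose (P \<gamma>) **
       poisson_conv (\<lambda>\<gamma>'. T \<gamma>' ** conj_transpose (P \<gamma>')) (fst \<gamma>) ** T \<gamma>"

end

theory Submission
  imports Defs
begin

text \<open>
  Since \<open>\<Phi>t = L \<Theta>\<close>, the antisymmetrized product of the \<open>\<phi>t\<close> equals \<open>det L / N!\<close> times the Slater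
  determinant of the \<open>\<theta>\<close>, and the \<open>\<theta>\<close> are biorthogonal to the \<open>\<phi>\<close>. Hence, for the potential of a
  single pair \<open>(i, j)\<close>, integrating out all other particles leaves only the identity and the
  transposition of \<open>i\<close> and \<open>j\<close> in the determinant: the direct and the exchange term.
  Absolute convergence is only known for the whole configuration integral, but it passes to each
  pair because the pair potentials are nonnegative, and then to the two-particle integrals by Fubini.
\<close>

section \<open>Product measures: separating two coordinates from the rest\<close>

text \<open>A product measure over a finite index set is determined by its values on boxes, and the
  preimage of a box under \<open>T\<close> is again a box, so both sides give the same product of
  factors. The restriction in \<open>T\<close> is there because points of \<open>PiM I M\<close> are
  extensional functions on \<open>I\<close>.\<close>

lemma (in product_sigma_finite) distr_pair_merge_PiM:
  fixes i j :: 'i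
  assumes fin: "finite I" and ij: "i \<in> I" "j \<in> I" "i \<noteq> j"
  defines "T \<equiv> (\<lambda>z. \<lambda>k\<in>I. if k = i then fst (fst z) else if k = j then snd (fst z) else snd z k)"
  shows "T \<in> (M i \<Otimes>\<^sub>M M j) \<Otimes>\<^sub>M PiM (I - {i, j}) M \<rightarrow>\<^sub>M PiM I M"
    and "distr ((M i \<Otimes>\<^sub>M M j) \<Otimes>\<^sub>M PiM (I - {i, j}) M) (PiM I M) T = PiM I M"
proof -
  let ?J = "I - {i, j}"
  let ?P = "(M i \<Otimes>\<^sub>M M j) \<Otimes>\<^sub>M PiM ?J M"
  interpret MJ: sigma_finite_measure "PiM ?J M" using fin by (intro sigma_finite) simp
  show T: "T \<in> ?P \<rightarrow>\<^sub>M PiM I M"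
    unfolding T_def
  proof (rule measurable_restrict)
    fix k assume "k \<in> I"
    then show "(\<lambda>z. if k = i then fst (fst z) else if k = j then snd (fst z) else snd z k)
        \<in> ?P \<rightarrow>\<^sub>M M k"
      by (cases "k = i"; cases "k = j") auto
  qed
  show "distr ?P (PiM I M) T = PiM I M"
  proof (rule PiM_eqI[OF fin])
    fix A assume A: "\<And>k. k \<in> I \<Longrightarrow> A k \<in> sets (M k)"
    have AI: "Pi\<^sub>E I A \<in> sets (PiM I M)" using fin A by (rule sets_PiM_I_finite)
    have AJ: "Pi\<^sub>E ?J A \<in> sets (PiM ?J M)" using fin A by (intro sets_PiM_I_finite) auto
    have emJ: "emeasure (PiM ?J M) (Pi\<^sub>E ?J A) = (\<Prod>k\<in>?J. emeasure (M k) (A k))"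
      by (rule emeasure_PiM) (use fin A in auto)
    have sub: "A k \<subseteq> space (M k)" if "k \<in> I" for k using A[OF that] by (rule sets.sets_into_space)
    \<comment> \<open>\<open>T\<close> never reads \<open>snd z\<close> outside
      \<open>I - {i, j}\<close>; only the intersection with the space forces \<open>snd z\<close> to
      be extensional there.\<close>
    have eq: "T -` Pi\<^sub>E I A \<inter> space ?P = (A i \<times> A j) \<times> Pi\<^sub>E ?J A"
    proof (intro set_eqI iffI)
      fix z assume z: "z \<in> T -` Pi\<^sub>E I A \<inter> space ?P"
      then have m: "T z k \<in> A k" if "k \<in> I" for k using that by auto
      have "snd z k \<in> A k" if "k \<in> ?J" for k using m[of k] that by (auto simp: T_def)
      moreover have "fst (fst z) \<in> A i" "snd (fst z) \<in> A j"
        using m[of i] m[of j] ij by (auto simp: T_def)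
      moreover have "snd z \<in> extensional ?J"
        using z by (auto simp: space_pair_measure space_PiM PiE_def)
      ultimately show "z \<in> (A i \<times> A j) \<times> Pi\<^sub>E ?J A" by (auto simp: mem_Times_iff PiE_def)
    next
      fix z assume z: "z \<in> (A i \<times> A j) \<times> Pi\<^sub>E ?J A"
      then have ab: "fst (fst z) \<in> A i" "snd (fst z) \<in> A j" and y: "snd z \<in> Pi\<^sub>E ?J A"
        by (simp_all add: mem_Times_iff)
      have m: "snd z k \<in> A k" if "k \<in> ?J" for k using y that by (rule PiE_mem)
      have "snd z \<in> Pi\<^sub>E ?J (\<lambda>k. space (M k))"
        by (rule subsetD[OF PiE_mono y]) (simp add: sub)
      then have "z \<in> space ?P"
        using ab sub[OF ij(1)] sub[OF ij(2)]
        by (simp add: space_pair_measure space_PiM mem_Times_iff subset_iff)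
      moreover have "T z \<in> Pi\<^sub>E I A"
        unfolding T_def by (rule restrict_PiE_iff[THEN iffD2]) (use ab m in simp)
      ultimately show "z \<in> T -` Pi\<^sub>E I A \<inter> space ?P" by auto
    qed
    have "emeasure (distr ?P (PiM I M) T) (Pi\<^sub>E I A) = emeasure ?P ((A i \<times> A j) \<times> Pi\<^sub>E ?J A)"
      using T AI by (simp add: emeasure_distr eq)
    also have "\<dots> = emeasure (M i) (A i) * emeasure (M j) (A j) * (\<Prod>k\<in>?J. emeasure (M k) (A k))"
      using A AJ ij
      by (simp add: MJ.emeasure_pair_measure_Times emJ
        sigma_finite_measure.emeasure_pair_measure_Times[OF sigma_finite_measures])
    also have "\<dots> = (\<Prod>k\<in>insert i (insert j ?J). emeasure (M k) (A k))"
      using ij fin by (simp add: mult.assoc)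
    also have "insert i (insert j ?J) = I" using ij by auto
    finally show "emeasure (distr ?P (PiM I M) T) (Pi\<^sub>E I A) = (\<Prod>k\<in>I. emeasure (M k) (A k))" .
  qed simp
qed

text \<open>Fubini after transport along the merging map, with all coordinates except
  \<open>i\<close> and \<open>j\<close> integrated first. Integrability of \<open>g\<close> is among
  the conclusions because this is how absolute convergence reaches the two-particle
  functions.\<close>

lemma (in product_sigma_finite) integral_PiM_split_pair:
  fixes f :: "('i \<Rightarrow> 'a) \<Rightarrow> 'c::{banach, second_countable_topology}"
  assumes fin: "finite I" and ij: "i \<in> I" "j \<in> I" "i \<noteq> j" and f: "integrable (PiM I M) f"
  defines "g \<equiv> (\<lambda>(a, b). \<integral>y. f (\<lambda>k\<in>I. if k = i then a else if k = j then b else y k)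
                  \<partial>PiM (I - {i, j}) M)"
  shows "integrable (M i \<Otimes>\<^sub>M M j) g" and "integral\<^sup>L (M i \<Otimes>\<^sub>M M j) g = integral\<^sup>L (PiM I M) f"
proof -
  let ?J = "I - {i, j}"
  let ?P = "(M i \<Otimes>\<^sub>M M j) \<Otimes>\<^sub>M PiM ?J M"
  let ?T = "\<lambda>z. \<lambda>k\<in>I. if k = i then fst (fst z) else if k = j then snd (fst z) else snd z k"
  note T = distr_pair_merge_PiM[OF fin ij]
  interpret pair_sigma_finite "M i \<Otimes>\<^sub>M M j" "PiM ?J M"
  proof (rule pair_sigma_finite.intro)
    show "sigma_finite_measure (M i \<Otimes>\<^sub>M M j)"
      by (rule sigma_finite_pair_measure) (rule sigma_finite_measures)+
    show "sigma_finite_measure (PiM ?J M)"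
      by (rule sigma_finite) (simp add: fin)
  qed
  have fT: "integrable ?P (\<lambda>z. f (?T z))"
    by (rule integrable_distr[OF T(1)]) (simp only: T(2) f)
  have g: "g = (\<lambda>x. \<integral>y. f (?T (x, y)) \<partial>PiM ?J M)"
    by (rule ext) (simp add: g_def split_beta cong: if_cong)
  show "integrable (M i \<Otimes>\<^sub>M M j) g"
    unfolding g using fT by (rule integrable_fst')
  have "integral\<^sup>L (M i \<Otimes>\<^sub>M M j) g = (\<integral>z. f (?T z) \<partial>?P)"
    unfolding g using fT by (rule integral_fst')
  also have "\<dots> = integral\<^sup>L (distr ?P (PiM I M) ?T) f"
    using T(1) borel_measurable_integrable[OF f] by (rule integral_distr[symmetric])
  finally show "integral\<^sup>L (M i \<Otimes>\<^sub>M M j) g = integral\<^sup>L (PiM I M) f"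
    by (simp only: T(2))
qed

section \<open>Reduction to two particles by biorthogonality\<close>

lemma prod_UNIV_split_pair:
  fixes f :: "'n::finite \<Rightarrow> 'a::comm_monoid_mult"
  assumes "i \<noteq> j"
  shows "(\<Prod>k\<in>UNIV. f k) = f i * f j * (\<Prod>k\<in>UNIV - {i, j}. f k)"
proof -
  have "(\<Prod>k\<in>insert i (insert j (UNIV - {i, j})). f k) = f i * f j * (\<Prod>k\<in>UNIV - {i, j}. f k)"
    using assms by (simp add: mult.assoc)
  moreover have "insert i (insert j (UNIV - {i, j})) = UNIV" by auto
  ultimately show ?thesis by simp
qed

text \<open>For fixed \<open>a\<close> and \<open>b\<close> every Leibniz term is a product of
  one-variable functions, and each remaining coordinate \<open>l\<close> contributes the overlap of
  \<open>\<theta> (p l)\<close> with \<open>\<phi> l\<close>, which is 1 or 0. Integrability of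
  \<open>w\<close> against pairs of orbitals is not presupposed: that of \<open>g\<close> comes from
  \<open>f\<close> by Fubini.\<close>

lemma two_body_integral:
  fixes \<theta> \<phi> :: "'n::finite \<Rightarrow> 'a \<Rightarrow> complex" and w :: "'a \<Rightarrow> 'a \<Rightarrow> complex"
  assumes sf: "sigma_finite_measure M" and ij: "i \<noteq> j"
    and int: "\<And>k l. integrable M (\<lambda>x. \<theta> k x * cnj (\<phi> l x))"
    and biorth: "\<And>k l. (\<integral>x. \<theta> k x * cnj (\<phi> l x) \<partial>M) = (if k = l then 1 else 0)"
    and f: "integrable (PiM UNIV (\<lambda>_. M))
      (\<lambda>\<gamma>. w (\<gamma> i) (\<gamma> j) * (det (\<chi> k l. \<theta> k (\<gamma> l)) * (\<Prod>k\<in>UNIV. cnj (\<phi> k (\<gamma> k)))))"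
  defines "g \<equiv> (\<lambda>(a, b). w a b * ((\<theta> i a * \<theta> j b - \<theta> j a * \<theta> i b) * (cnj (\<phi> i a) * cnj (\<phi> j b))))"
  shows "integrable (M \<Otimes>\<^sub>M M) g"
    and "integral\<^sup>L (M \<Otimes>\<^sub>M M) g = (\<integral>\<gamma>. w (\<gamma> i) (\<gamma> j) *
      (det (\<chi> k l. \<theta> k (\<gamma> l)) * (\<Prod>k\<in>UNIV. cnj (\<phi> k (\<gamma> k)))) \<partial>PiM UNIV (\<lambda>_. M))"
proof -
  let ?J = "UNIV - {i, j}"
  let ?U = "{p. p permutes (UNIV :: 'n set)}"
  let ?F = "\<lambda>\<gamma>. w (\<gamma> i) (\<gamma> j) * (det (\<chi> k l. \<theta> k (\<gamma> l)) * (\<Prod>k\<in>UNIV. cnj (\<phi> k (\<gamma> k))))"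
  let ?T = "\<lambda>a b (y :: 'n \<Rightarrow> 'a). \<lambda>k\<in>UNIV. if k = i then a else if k = j then b else y k"
  define h where "h l k x = \<theta> k x * cnj (\<phi> l x)" for k l x
  interpret sigma_finite_measure M by (rule sf)
  interpret product_sigma_finite "\<lambda>_ :: 'n. M" by standard
  have F: "?F \<gamma> = w (\<gamma> i) (\<gamma> j) * (\<Sum>p\<in>?U. of_int (sign p) * (\<Prod>l\<in>UNIV. h l (p l) (\<gamma> l)))" for \<gamma>
  proof -
    \<comment> \<open>The transpose makes the Leibniz product run over the variables, so that
      \<open>\<theta> (p l) (\<gamma> l)\<close> meets \<open>cnj (\<phi> l (\<gamma> l))\<close> in
      the same variable.\<close>
    have "(\<chi> k l. \<theta> k (\<gamma> l)) = transpose (\<chi> l k. \<theta> k (\<gamma> l))" by (simp add: transpose_def)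
    then have "det (\<chi> k l. \<theta> k (\<gamma> l)) = det (\<chi> l k. \<theta> k (\<gamma> l))" by simp
    also have "\<dots> = (\<Sum>p\<in>?U. of_int (sign p) * (\<Prod>l\<in>UNIV. \<theta> (p l) (\<gamma> l)))" by (simp add: det_def)
    finally show ?thesis by (simp add: h_def sum_distrib_right prod.distrib mult.assoc)
  qed
  have hprod: "integrable (PiM ?J (\<lambda>_. M)) (\<lambda>y. \<Prod>l\<in>?J. h l (p l) (y l))"
    "(\<integral>y. (\<Prod>l\<in>?J. h l (p l) (y l)) \<partial>PiM ?J (\<lambda>_. M)) = (\<Prod>l\<in>?J. if p l = l then 1 else 0)" for p
  proof -
    have 1: "integrable M (h l (p l))" and 2: "integral\<^sup>L M (h l (p l)) = (if p l = l then 1 else 0)" for l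
      unfolding h_def using int biorth by auto
    show "integrable (PiM ?J (\<lambda>_. M)) (\<lambda>y. \<Prod>l\<in>?J. h l (p l) (y l))"
      by (rule product_integrable_prod) (simp_all add: 1)
    show "(\<integral>y. (\<Prod>l\<in>?J. h l (p l) (y l)) \<partial>PiM ?J (\<lambda>_. M)) = (\<Prod>l\<in>?J. if p l = l then 1 else 0)"
      by (subst product_integral_prod) (simp_all add: 1 2)
  qed
  have surviving: "{p \<in> ?U. \<forall>k\<in>?J. p k = k} = {id, Transposition.transpose i j}"
  proof -
    have "{p \<in> ?U. \<forall>k\<in>?J. p k = k} = {p. p permutes {i, j}}"
      by (auto simp: permutes_def)
    then show ?thesis by (auto simp: permutes_doubleton_iff)
  qed
  \<comment> \<open>This holds for every \<open>a\<close> and \<open>b\<close>, not only almost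
    everywhere: once they are frozen, \<open>w a b\<close> and \<open>c p\<close> are constants and
    the remaining products are integrable.\<close>
  have g: "(\<integral>y. ?F (?T a b y) \<partial>PiM ?J (\<lambda>_. M)) = g (a, b)" for a b
  proof -
    define c where "c p = of_int (sign p) * (h i (p i) a * h j (p j) b)" for p
    have FT: "?F (?T a b y) = w a b * (\<Sum>p\<in>?U. c p * (\<Prod>l\<in>?J. h l (p l) (y l)))" for y
      unfolding F using ij by (simp add: prod_UNIV_split_pair c_def mult.assoc cong: if_cong prod.cong_simp)
    have "(\<integral>y. ?F (?T a b y) \<partial>PiM ?J (\<lambda>_. M))
        = w a b * (\<Sum>p\<in>?U. c p * (\<integral>y. (\<Prod>l\<in>?J. h l (p l) (y l)) \<partial>PiM ?J (\<lambda>_. M)))"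
      unfolding FT integral_mult_right_zero
      by (subst Bochner_Integration.integral_sum) (simp_all add: hprod)
    also have "\<dots> = w a b * (\<Sum>p\<in>?U. c p * (\<Prod>l\<in>?J. if p l = l then 1 else 0))"
      by (simp add: hprod)
    \<comment> \<open>If \<open>p\<close> moves some \<open>l\<close> outside \<open>{i, j}\<close>,
      the overlap at \<open>l\<close> is zero and removes the term.\<close>
    also have "(\<Sum>p\<in>?U. c p * (\<Prod>l\<in>?J. if p l = l then 1 else 0)) = (\<Sum>p\<in>{p\<in>?U. \<forall>k\<in>?J. p k = k}. c p)"
      by (rule sum.mono_neutral_cong_right) (auto intro!: prod_zero)
    also have "\<dots> = c id + c (Transposition.transpose i j)"
    proof -
      have "id i \<noteq> Transposition.transpose i j i" using ij by simp
      then have "id \<noteq> Transposition.transpose i j" by metis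
      then show ?thesis unfolding surviving by simp
    qed
    also have "\<dots> = (\<theta> i a * \<theta> j b - \<theta> j a * \<theta> i b) * (cnj (\<phi> i a) * cnj (\<phi> j b))"
      using ij by (simp add: c_def h_def sign_swap_id algebra_simps)
    finally show ?thesis by (simp add: g_def)
  qed
  have g': "(\<lambda>(a, b). \<integral>y. ?F (?T a b y) \<partial>PiM ?J (\<lambda>_. M)) = g"
    by (rule ext, simp only: split_paired_all prod.case g)
  note split = integral_PiM_split_pair[OF finite[of UNIV] UNIV_I UNIV_I ij f, unfolded g']
  show "integrable (M \<Otimes>\<^sub>M M) g" by (rule split(1))
  show "integral\<^sup>L (M \<Otimes>\<^sub>M M) g = integral\<^sup>L (PiM UNIV (\<lambda>_. M)) ?F" by (rule split(2))
qed

section \<open>Square-integrable orbitals, the particle measure, determinants and inverses\<close>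

lemma borel_measurable_cnj [measurable]: "cnj \<in> borel_measurable borel"
  by (intro borel_measurable_continuous_onI continuous_intros)

lemma integrable_mult_cnj_square_integrable:
  assumes "square_integrable M f" "square_integrable M g"
  shows "integrable M (\<lambda>x. f x * cnj (g x))"
proof (rule Bochner_Integration.integrable_bound)
  have [measurable]: "f \<in> borel_measurable M" "g \<in> borel_measurable M"
    using assms by (auto simp: square_integrable_def)
  show "(\<lambda>x. f x * cnj (g x)) \<in> borel_measurable M"
    by measurable
  show "integrable M (\<lambda>x. (cmod (f x))\<^sup>2 + (cmod (g x))\<^sup>2)"
    using assms by (auto simp: square_integrable_def)
  show "AE x in M. norm (f x * cnj (g x)) \<le> norm ((cmod (f x))\<^sup>2 + (cmod (g x))\<^sup>2)"
  proof (intro AE_I2)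
    fix x
    \<comment> \<open>The square gives \<open>2 s t \<le> s^2 + t^2\<close> for the two moduli;
      nonnegativity of \<open>s t\<close> then allows the factor 2 to be dropped.\<close>
    have "0 \<le> (cmod (f x) - cmod (g x))\<^sup>2" "0 \<le> cmod (f x) * cmod (g x)" by simp_all
    then have "cmod (f x) * cmod (g x) \<le> (cmod (f x))\<^sup>2 + (cmod (g x))\<^sup>2"
      unfolding power2_diff by linarith
    then show "norm (f x * cnj (g x)) \<le> norm ((cmod (f x))\<^sup>2 + (cmod (g x))\<^sup>2)"
      by (simp add: norm_mult)
  qed
qed

lemma sigma_finite_particle_measure: "sigma_finite_measure particle_measure"
  unfolding particle_measure_def
  by (intro sigma_finite_pair_measure sigma_finite_lborel sigma_finite_measure_count_space_finite)
    (simp add: spins_def)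

text \<open>A null set of positions stays null after multiplication by the spins. This bridges
  \<open>poisson_converges\<close>, which speaks of almost every position, and the outer integral,
  which runs over particles.\<close>

lemma AE_particle_measure_fst:
  assumes "AE r in lborel. P r"
  shows "AE \<gamma> in particle_measure. P (fst \<gamma>)"
proof -
  interpret sigma_finite_measure "count_space spins"
    by (rule sigma_finite_measure_count_space_finite) (simp add: spins_def)
  from assms obtain N where N: "N \<in> null_sets lborel" "{r \<in> space lborel. \<not> P r} \<subseteq> N"
    unfolding eventually_ae_filter by auto
  have "N \<times> spins \<in> null_sets particle_measure"
    using N(1) by (auto simp: particle_measure_def null_sets_def emeasure_pair_measure_Times)
  then show ?thesis
    by (rule AE_I') (use N(2) in \<open>auto simp: particle_measure_def space_pair_measure\<close>)
qed

lemma measurable_fst_particle [measurable]: "fst \<in> particle_measure \<rightarrow>\<^sub>M borel"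
  by (simp add: particle_measure_def)

text \<open>Since \<open>antisymmetrizer\<close> permutes the variables and not the orbitals, its
  sum is literally the Leibniz formula with orbitals as rows.\<close>

lemma antisymmetrizer_orbital_product:
  "antisymmetrizer (orbital_product \<psi>) \<gamma> = det (\<chi> k l. \<psi> k (\<gamma> l)) / fact CARD('n)"
  for \<psi> :: "'n::finite \<Rightarrow> particle \<Rightarrow> complex"
  by (simp add: antisymmetrizer_def orbital_product_def det_def)

text \<open>\<open>matrix_inv\<close> is a choice, so its properties must be drawn from
  \<open>invertible\<close>. The right inverse recovers \<open>\<phi>t\<close> from
  \<open>\<Theta>\<close>, the left inverse yields biorthogonality.\<close>

lemma
  fixes A :: "'a::semiring_1^'n^'m"
  assumes "invertible A"
  shows matrix_inv_left_inverse: "matrix_inv A ** A = mat 1"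
    and matrix_inv_right_inverse: "A ** matrix_inv A = mat 1"
proof -
  have "A ** matrix_inv A = mat 1 \<and> matrix_inv A ** A = mat 1"
    using assms unfolding invertible_def matrix_inv_def by (rule someI_ex)
  then show "matrix_inv A ** A = mat 1" "A ** matrix_inv A = mat 1" by auto
qed

section \<open>The matrix element of the interaction potential\<close>

theorem proposition6:
  fixes \<phi> \<phi>t :: "'n::finite \<Rightarrow> particle \<Rightarrow> complex"
    and L :: "complex^'n^'n"
    and \<Phi> \<Phi>t \<Theta> :: "particle \<Rightarrow> complex^1^'n"
  defines "L \<equiv> overlap_matrix \<phi>t \<phi>"
    and "\<Phi> \<equiv> orbital_column \<phi>"
    and "\<Phi>t \<equiv> orbital_column \<phi>t"
    and "\<Theta> \<equiv> (\<lambda>\<gamma>. matrix_inv L ** \<Phi>t \<gamma>)"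
  assumes "\<And>i. square_integrable particle_measure (\<phi> i)"
    and "\<And>i. square_integrable particle_measure (\<phi>t i)"
    and "invertible L"
    and "integrable configuration_measure
           (inner_integrand (antisymmetrizer (orbital_product \<phi>t))
              (\<lambda>\<gamma>. of_real (interaction_potential \<gamma>) * orbital_product \<phi> \<gamma>))"
    and "poisson_converges (\<lambda>\<gamma>. conj_transpose (\<Phi> \<gamma>) ** \<Theta> \<gamma>)"
    and "poisson_converges (\<lambda>\<gamma>. \<Theta> \<gamma> ** conj_transpose (\<Phi> \<gamma>))"
    and "integrable particle_measure (\<lambda>\<gamma>. direct_minus_exchange \<Phi> \<Theta> \<gamma> $ 1 $ 1)"
  shows "inner_L2 configuration_measure
           (antisymmetrizer (orbital_product \<phi>t))
           (\<lambda>\<gamma>. of_real (interaction_potential \<gamma>) * orbital_product \<phi> \<gamma>)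
         = 1/2 * (det L / fact CARD('n)) *
           (\<integral>\<gamma>. direct_minus_exchange \<Phi> \<Theta> \<gamma> $ 1 $ 1 \<partial>particle_measure)"
proof -
  note sq = assms(5,6) and inv = assms(7) and intN = assms(8) and conv = assms(10) and intD = assms(11)
  let ?M = particle_measure
  let ?C = "PiM (UNIV :: 'n set) (\<lambda>_. ?M)"
  let ?O = "{(i, j). i \<noteq> j} :: ('n \<times> 'n) set"
  define c :: complex where "c = det L / fact CARD('n)"
  define \<theta> where "\<theta> k x = \<Theta> x $ k $ 1" for k x
  define w :: "particle \<Rightarrow> particle \<Rightarrow> complex" where "w a b = of_real (1 / norm (fst a - fst b))" for a b
  define D where "D \<gamma> = det (\<chi> k l. \<theta> k (\<gamma> l)) * (\<Prod>k\<in>UNIV. cnj (\<phi> k (\<gamma> k)))" for \<gamma>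
  \<comment> \<open>The integrand of \<open>two_body_integral\<close> with the pair as an argument;
    for \<open>i = j\<close> it vanishes identically.\<close>
  define g where "g = (\<lambda>(i, j) (a, b). w a b *
    ((\<theta> i a * \<theta> j b - \<theta> j a * \<theta> i b) * (cnj (\<phi> i a) * cnj (\<phi> j b))))"
  have \<theta>: "\<theta> k x = (\<Sum>m\<in>UNIV. matrix_inv L $ k $ m * \<phi>t m x)" for k x
    by (simp add: \<theta>_def \<Theta>_def \<Phi>t_def orbital_column_def columnvector_def matrix_matrix_mult_def)
  have \<phi>t: "\<phi>t k x = (\<Sum>m\<in>UNIV. L $ k $ m * \<theta> m x)" for k x
  proof -
    have "L ** \<Theta> x = \<Phi>t x"
      by (simp add: \<Theta>_def matrix_mul_assoc matrix_inv_right_inverse[OF inv])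
    then have "(L ** \<Theta> x) $ k $ 1 = \<phi>t k x"
      by (simp add: \<Phi>t_def orbital_column_def columnvector_def)
    then show ?thesis by (simp add: matrix_matrix_mult_def \<theta>_def)
  qed
  have [measurable]: "\<phi> k \<in> borel_measurable ?M" "\<phi>t k \<in> borel_measurable ?M" for k
    using sq by (auto simp: square_integrable_def)
  have [measurable]: "\<theta> k \<in> borel_measurable ?M" for k
    unfolding \<theta>[abs_def] by measurable
  have int\<phi>t: "integrable ?M (\<lambda>x. \<phi>t k x * cnj (\<phi> l x))" for k l
    using sq by (intro integrable_mult_cnj_square_integrable)
  have \<theta>\<phi>: "\<theta> k x * cnj (\<phi> l x) = (\<Sum>m\<in>UNIV. matrix_inv L $ k $ m * (\<phi>t m x * cnj (\<phi> l x)))" for k l x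
    by (simp add: \<theta> sum_distrib_right mult.assoc)
  have int: "integrable ?M (\<lambda>x. \<theta> k x * cnj (\<phi> l x))" for k l
    unfolding \<theta>\<phi> using int\<phi>t by (intro Bochner_Integration.integrable_sum integrable_mult_right)
  have biorth: "(\<integral>x. \<theta> k x * cnj (\<phi> l x) \<partial>?M) = (if k = l then 1 else 0)" for k l
  proof -
    have "(\<integral>x. \<theta> k x * cnj (\<phi> l x) \<partial>?M)
        = (\<Sum>m\<in>UNIV. matrix_inv L $ k $ m * (\<integral>x. \<phi>t m x * cnj (\<phi> l x) \<partial>?M))"
      unfolding \<theta>\<phi> using int\<phi>t by (subst Bochner_Integration.integral_sum) simp_all
    \<comment> \<open>The remaining integrals are by definition the entries of
      \<open>L\<close>.\<close>
    also have "\<dots> = (matrix_inv L ** L) $ k $ l"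
      by (simp add: matrix_matrix_mult_def L_def overlap_matrix_def inner_L2_def inner_integrand_def)
    finally show ?thesis by (simp add: matrix_inv_left_inverse[OF inv] mat_def)
  qed
  have integrand: "inner_integrand (antisymmetrizer (orbital_product \<phi>t))
      (\<lambda>\<gamma>. of_real (interaction_potential \<gamma>) * orbital_product \<phi> \<gamma>)
      = (\<lambda>\<gamma>. c * (of_real (interaction_potential \<gamma>) * D \<gamma>))"
  proof
    fix \<gamma> :: "'n \<Rightarrow> particle"
    \<comment> \<open>The matrix of orbital values factors through \<open>L\<close>, so
      multiplicativity of the determinant produces the constant \<open>c\<close>.\<close>
    have "(\<chi> k l. \<phi>t k (\<gamma> l)) = L ** (\<chi> k l. \<theta> k (\<gamma> l))"
      by (simp add: vec_eq_iff matrix_matrix_mult_def \<phi>t)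
    then have "det (\<chi> k l. \<phi>t k (\<gamma> l)) = det L * det (\<chi> k l. \<theta> k (\<gamma> l))"
      by (simp add: det_mul)
    then show "inner_integrand (antisymmetrizer (orbital_product \<phi>t))
        (\<lambda>\<gamma>. of_real (interaction_potential \<gamma>) * orbital_product \<phi> \<gamma>) \<gamma>
        = c * (of_real (interaction_potential \<gamma>) * D \<gamma>)"
      unfolding inner_integrand_def antisymmetrizer_orbital_product
      by (simp add: orbital_product_def D_def c_def)
  qed
  have "c \<noteq> 0" using inv by (simp add: c_def invertible_det_nz)
  \<comment> \<open>Nonsingularity of \<open>L\<close> enters again here: dividing by
    \<open>c\<close> turns the assumed integrability into that of the potential times
    \<open>D\<close>.\<close>
  then have intVD: "integrable ?C (\<lambda>\<gamma>. of_real (interaction_potential \<gamma>) * D \<gamma>)"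
    using integrable_mult_right[OF intN[unfolded integrand configuration_measure_def], of "inverse c"]
    by (simp add: field_simps)
  have potential: "of_real (interaction_potential \<gamma>) = 1/2 * (\<Sum>(i, j)\<in>?O. w (\<gamma> i) (\<gamma> j))"
    for \<gamma> :: "'n \<Rightarrow> particle"
    by (simp add: interaction_potential_def w_def case_prod_beta)
  have [measurable]: "D \<in> borel_measurable ?C"
  proof -
    have [measurable]: "(\<lambda>\<gamma>. \<theta> k (\<gamma> l)) \<in> borel_measurable ?C" for k l
      by (rule measurable_compose[of "\<lambda>\<gamma>. \<gamma> l" _ ?M]) simp_all
    have [measurable]: "(\<lambda>\<gamma>. \<phi> k (\<gamma> l)) \<in> borel_measurable ?C" for k l
      by (rule measurable_compose[of "\<lambda>\<gamma>. \<gamma> l" _ ?M]) simp_all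
    show ?thesis unfolding D_def[abs_def] det_def by simp measurable
  qed
  have intwD: "integrable ?C (\<lambda>\<gamma>. w (\<gamma> i) (\<gamma> j) * D \<gamma>)" if "i \<noteq> j" for i j
  proof (rule Bochner_Integration.integrable_bound)
    \<comment> \<open>The factor 2 undoes the 1/2 in the potential, so the majorant dominates each
      single ordered pair. Where two positions coincide, \<open>1 / 0 = 0\<close> is still
      nonnegative, so the bound holds at every configuration.\<close>
    show "integrable ?C (\<lambda>\<gamma>. 2 * (of_real (interaction_potential \<gamma>) * D \<gamma>))"
      using intVD by simp
    have [measurable]: "(\<lambda>\<gamma>. fst (\<gamma> l)) \<in> borel_measurable ?C" for l
      by (rule measurable_compose[of "\<lambda>\<gamma>. \<gamma> l" _ ?M]) simp_all
    show "(\<lambda>\<gamma>. w (\<gamma> i) (\<gamma> j) * D \<gamma>) \<in> borel_measurable ?C"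
      unfolding w_def by measurable
    show "AE \<gamma> in ?C. norm (w (\<gamma> i) (\<gamma> j) * D \<gamma>) \<le> norm (2 * (of_real (interaction_potential \<gamma>) * D \<gamma>))"
    proof (intro AE_I2)
      fix \<gamma> :: "'n \<Rightarrow> particle"
      let ?v = "\<lambda>p. 1 / norm (fst (\<gamma> (fst p)) - fst (\<gamma> (snd p)))"
      have "?v (i, j) \<le> (\<Sum>p\<in>?O. ?v p)"
        using that by (intro member_le_sum) auto
      also have "\<dots> = 2 * interaction_potential \<gamma>"
        by (simp add: interaction_potential_def case_prod_beta)
      finally have "norm (w (\<gamma> i) (\<gamma> j)) \<le> norm (2 * complex_of_real (interaction_potential \<gamma>))"
        by (simp add: w_def norm_divide norm_mult)
      then have "norm (w (\<gamma> i) (\<gamma> j)) * norm (D \<gamma>)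
          \<le> norm (2 * complex_of_real (interaction_potential \<gamma>)) * norm (D \<gamma>)"
        by (rule mult_right_mono) simp
      then show "norm (w (\<gamma> i) (\<gamma> j) * D \<gamma>) \<le> norm (2 * (of_real (interaction_potential \<gamma>) * D \<gamma>))"
        by (simp add: norm_mult mult.assoc)
    qed
  qed
  have pair: "integrable (?M \<Otimes>\<^sub>M ?M) (g (i, j))"
    "integral\<^sup>L (?M \<Otimes>\<^sub>M ?M) (g (i, j)) = (\<integral>\<gamma>. w (\<gamma> i) (\<gamma> j) * D \<gamma> \<partial>?C)" if "i \<noteq> j" for i j
    using two_body_integral[OF sigma_finite_particle_measure that int biorth, of w] intwD[OF that]
    by (simp_all add: g_def D_def)
  \<comment> \<open>The diagonal is included, where direct and exchange parts cancel: only full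
    double sums turn into the matrix products of \<open>direct_minus_exchange\<close>.\<close>
  define G where "G = (\<lambda>(a, b). \<Sum>i\<in>UNIV. \<Sum>j\<in>UNIV. g (i, j) (a, b))"
  have G: "G x = (\<Sum>p\<in>?O. g p x)" for x
  proof -
    have "G x = (\<Sum>p\<in>UNIV. g p x)"
      by (simp add: G_def case_prod_beta sum.cartesian_product UNIV_Times_UNIV)
    also have "\<dots> = (\<Sum>p\<in>?O. g p x)"
      by (rule sum.mono_neutral_right) (auto simp: g_def)
    finally show ?thesis .
  qed
  have mult_1x1: "(A ** B) $ 1 $ 1 = A $ 1 $ 1 * B $ 1 $ 1" for A B :: "complex^1^1"
    by (simp add: matrix_matrix_mult_def)
  interpret pair_sigma_finite ?M ?M
    by (intro pair_sigma_finite.intro sigma_finite_particle_measure)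
  have intG: "integrable (?M \<Otimes>\<^sub>M ?M) G"
    unfolding G[abs_def] using pair by (intro Bochner_Integration.integrable_sum) auto
  \<comment> \<open>Only almost every \<open>a\<close> can be treated: elsewhere the Poisson
    integrals may diverge, and the inner integral could not be split term by term.\<close>
  have inner: "AE a in ?M. direct_minus_exchange \<Phi> \<Theta> a $ 1 $ 1 = (\<integral>b. G (a, b) \<partial>?M)"
  proof -
    have P: "poisson_integrand (\<lambda>\<gamma>. (\<Theta> \<gamma> ** conj_transpose (\<Phi> \<gamma>)) $ i $ j) (fst a)
        = (\<lambda>b. w a b * (\<theta> i b * cnj (\<phi> j b)))" for i j a
      by (simp add: poisson_integrand_def fun_eq_iff matrix_matrix_mult_def conj_transpose_def
          \<Phi>_def orbital_column_def columnvector_def \<theta>_def w_def)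
    have "AE a in ?M. \<forall>i j. integrable ?M (\<lambda>b. w a b * (\<theta> i b * cnj (\<phi> j b)))"
      using AE_particle_measure_fst[OF conv[unfolded poisson_converges_def]] by (simp only: P)
    then show ?thesis
    proof eventually_elim
      case (elim a)
      define K where "K i j = (\<integral>b. w a b * (\<theta> i b * cnj (\<phi> j b)) \<partial>?M)" for i j
      have KE: "poisson_conv (\<lambda>\<gamma>'. \<Theta> \<gamma>' ** conj_transpose (\<Phi> \<gamma>')) (fst a) = (\<chi> i j. K i j)"
        by (simp add: poisson_conv_def P K_def)
      \<comment> \<open>The density of the direct term is the trace of the exchange matrix
        \<open>\<Theta> \<Phi>^*\<close>, so its convolution is the trace of
        \<open>K\<close>.\<close>
      have "poisson_integrand (\<lambda>\<gamma>. (conj_transpose (\<Phi> \<gamma>) ** \<Theta> \<gamma>) $ 1 $ 1) (fst a)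
          = (\<lambda>b. \<Sum>j\<in>UNIV. w a b * (\<theta> j b * cnj (\<phi> j b)))"
        by (simp add: poisson_integrand_def fun_eq_iff matrix_matrix_mult_def conj_transpose_def
          \<Phi>_def orbital_column_def columnvector_def \<theta>_def w_def sum_distrib_left mult.commute)
      then have KD: "poisson_conv (\<lambda>\<gamma>'. conj_transpose (\<Phi> \<gamma>') ** \<Theta> \<gamma>') (fst a) $ 1 $ 1 = (\<Sum>j\<in>UNIV. K j j)"
        using elim by (simp add: poisson_conv_def K_def)
      have "G (a, b) = (\<Sum>i\<in>UNIV. \<Sum>j\<in>UNIV.
          (cnj (\<phi> i a) * \<theta> i a) * (w a b * (\<theta> j b * cnj (\<phi> j b)))
          - (cnj (\<phi> i a) * \<theta> j a) * (w a b * (\<theta> i b * cnj (\<phi> j b))))" for b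
        by (simp add: G_def g_def algebra_simps)
      then have "(\<integral>b. G (a, b) \<partial>?M) = (\<Sum>i\<in>UNIV. \<Sum>j\<in>UNIV.
          (cnj (\<phi> i a) * \<theta> i a) * K j j - (cnj (\<phi> i a) * \<theta> j a) * K i j)"
        using elim by (simp add: K_def)
      also have "\<dots> = (\<Sum>i\<in>UNIV. cnj (\<phi> i a) * \<theta> i a) * (\<Sum>j\<in>UNIV. K j j)
          - (\<Sum>i\<in>UNIV. \<Sum>j\<in>UNIV. (cnj (\<phi> i a) * \<theta> j a) * K i j)"
        by (simp add: sum_subtractf sum_product)
      \<comment> \<open>The swap matches the bracketing of the exchange term, a row times
        \<open>K\<close> first and then the column.\<close>
      also have "(\<Sum>i\<in>UNIV. \<Sum>j\<in>UNIV. (cnj (\<phi> i a) * \<theta> j a) * K i j)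
          = (\<Sum>j\<in>UNIV. (\<Sum>i\<in>UNIV. cnj (\<phi> i a) * K i j) * \<theta> j a)"
        by (subst sum.swap) (simp add: sum_distrib_left mult_ac)
      also have "(\<Sum>i\<in>UNIV. cnj (\<phi> i a) * \<theta> i a) * (\<Sum>j\<in>UNIV. K j j)
          - (\<Sum>j\<in>UNIV. (\<Sum>i\<in>UNIV. cnj (\<phi> i a) * K i j) * \<theta> j a)
          = direct_minus_exchange \<Phi> \<Theta> a $ 1 $ 1"
        unfolding direct_minus_exchange_def KE vector_minus_component mult_1x1 KD
        by (simp add: matrix_matrix_mult_def conj_transpose_def \<Phi>_def orbital_column_def
            columnvector_def \<theta>_def)
      finally show ?case by simp
    qed
  qed
  have "(\<integral>\<gamma>. of_real (interaction_potential \<gamma>) * D \<gamma> \<partial>?C)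
      = (\<integral>\<gamma>. 1/2 * (\<Sum>p\<in>?O. w (\<gamma> (fst p)) (\<gamma> (snd p)) * D \<gamma>) \<partial>?C)"
    by (simp add: potential sum_distrib_right case_prod_beta)
  also have "\<dots> = 1/2 * (\<Sum>p\<in>?O. \<integral>\<gamma>. w (\<gamma> (fst p)) (\<gamma> (snd p)) * D \<gamma> \<partial>?C)"
    unfolding integral_mult_right_zero using intwD by (subst Bochner_Integration.integral_sum) auto
  also have "\<dots> = 1/2 * (\<Sum>p\<in>?O. integral\<^sup>L (?M \<Otimes>\<^sub>M ?M) (g p))"
    using pair by (intro arg_cong2[where f = "(*)"] sum.cong refl) auto
  also have "(\<Sum>p\<in>?O. integral\<^sup>L (?M \<Otimes>\<^sub>M ?M) (g p)) = integral\<^sup>L (?M \<Otimes>\<^sub>M ?M) G"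
    unfolding G[abs_def] using pair by (intro Bochner_Integration.integral_sum[symmetric]) auto
  also have "\<dots> = (\<integral>a. (\<integral>b. G (a, b) \<partial>?M) \<partial>?M)"
    using intG by (rule integral_fst'[symmetric])
  \<comment> \<open>Equality almost everywhere suffices once both sides are measurable; for the
    right side this comes from the assumed integrability of
    \<open>direct_minus_exchange\<close>.\<close>
  also have "\<dots> = (\<integral>a. direct_minus_exchange \<Phi> \<Theta> a $ 1 $ 1 \<partial>?M)"
    using inner by (intro integral_cong_AE borel_measurable_integrable[OF integrable_fst'[OF intG]]
        borel_measurable_integrable[OF intD]) auto
  finally have "(\<integral>\<gamma>. of_real (interaction_potential \<gamma>) * D \<gamma> \<partial>?C)
      = 1/2 * (\<integral>a. direct_minus_exchange \<Phi> \<Theta> a $ 1 $ 1 \<partial>?M)" .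
  then show ?thesis
    unfolding inner_L2_def integrand configuration_measure_def integral_mult_right_zero
    by (simp only: c_def) simp
qed

end
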